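(* Let $\Delta$ be any dynamic theory, and let $\alpha$ range over programs of $\Delta$, $\phi,\psi$ over $\Delta$-formulas and $v$ over variables of $\Delta$. Then the following rule and axioms are sound for $\Delta$: (G) if $\phi$ is $\Delta$-valid then $[\alpha]\phi$ is $\Delta$-valid; (K) $[\alpha](\phi\to\psi)\to([\alpha]\phi\to[\alpha]\psi)$ is $\Delta$-valid; (V) $\phi\to[\alpha]\phi$ is $\Delta$-valid whenever $\mathrm{FV}^{sem}(\phi)\cap\mathrm{BV}^{sem}(\alpha)=\emptyset$; (B) $(\forall v\,[\alpha]\phi)\leftrightarrow([\alpha]\forall v\,\phi)$ is $\Delta$-valid whenever $v\notin \mathrm{FV}^{sem}(\alpha)\cup\mathrm{BV}^{sem}(\alpha)$.
   Context: A dynamic theory $\Delta$ consists of: pairwise disjoint sets $\mathcal V$ (variables), $\mathcal A$ (atoms), $\mathcal P$ (programs); a nonempty set $U$ (universe); a nonempty set $S$ of states with a map $\mathrm{val}:S\times\mathcal V\to U$ satisfying interpolation (for all $\mu,\nu\in S$ and $W\subseteq\mathcal V$ there is $\omega\in S$ with $\mathrm{val}(\omega,v)=\mathrm{val}(\mu,v)$ for $v\in W$ and $\mathrm{val}(\omega,v)=\mathrm{val}(\nu,v)$ for $v\notin W$); an atom evaluation $\mathcal E_A:\mathcal A\to 2^S$ with $\mathrm{FV}_A:\mathcal A\to 2^{\mathcal V}$ such that each $\mathrm{FV}_A(a)$ is finite and states agreeing on $\mathrm{FV}_A(a)$ either both lie in $\mathcal E_A(a)$ or neither does; a program evaluation $\mathcal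 E_P:\mathcal P\to 2^{S\times S}$ with $\mathrm{FV}_P:\mathcal P\to 2^{\mathcal V}$ such that each $\mathrm{FV}_P(p)$ is finite, (overapproximation) for all $p$, all $\mu,\nu,\omega\in S$ and all $W\supseteq \mathrm{FV}_P(p)$: if $\mu=_W\nu$ and $(\mu,\omega)\in\mathcal E_P(p)$ then there is $\tilde\omega$ with $(\nu,\tilde\omega)\in\mathcal E_P(p)$ and $\omega=_W\tilde\omega$, and (extensionality) if $\mu=_{\mathcal V}\nu$ then $(\mu,\omega)\in\mathcal E_P(p)$ iff $(\nu,\omega)\in\mathcal E_P(p)$. Here $\mu=_W\nu$ means $\mathrm{val}(\mu,v)=\mathrm{val}(\nu,v)$ for all $v\in W$. Formulas: $F::=a\mid\neg F\mid F\wedge G\mid\forall v\,F\mid[p]F$ ($a\in\mathcal A,v\in\mathcal V,p\in\mathcal P$); $\langle p\rangle F$ abbreviates $\neg[p]\neg F$; other connectives and $\exists$ as usual. Semantics $[\![F]\!]\subseteq S$: $[\![a]\!]=\mathcal E_A(a)$, $[\![\neg F]\!]=S\setminus[\![F]\!]$, $[\![F\wedge G]\!]=[\![F]\!]\cap[\![G]\!]$, $[\![\forall v F]\!]=\{\mu:\forall\nu\,(\mu=_{\mathcal V\setminus\{v\}}\nu\Rightarrow\nu\in[\![F]\!])\}$, $[\![[p]F]\!]=\{\mu:\forall\nu\,((\mu,\nu)\in\mathcal E_P(p)\Rightarrow\nu\in[\![F]\!])\}$. $F$ is $\Delta$-valid iff $[\![F]\!]=S$. Semantic free/bound variables: $\mathrm{FV}^{sem}(F)=\{v:\exists\mu,\tilde\mu,\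 \mu=_{\mathcal V\setminus\{v\}}\tilde\mu,\ \mu\in[\![F]\!],\ \tilde\mu\notin[\![F]\!]\}$; $\mathrm{FV}^{sem}(p)=\{v:\exists\mu,\tilde\mu,\nu$ with $\mu=_{\mathcal V\setminus\{v\}}\tilde\mu$, $(\mu,\nu)\in\mathcal E_P(p)$, and no $\tilde\nu$ with $\nu=_{\mathcal V\setminus\{v\}}\tilde\nu$ and $(\tilde\mu,\tilde\nu)\in\mathcal E_P(p)\}$; $\mathrm{BV}^{sem}(p)=\{v:\exists(\mu,\tilde\mu)\in\mathcal E_P(p),\ \mathrm{val}(\mu,v)\neq\mathrm{val}(\tilde\mu,v)\}$. An axiom is sound if all its instances are valid; a rule is sound if validity of its premises implies validity of its conclusion. *)

theory Defs
  imports Main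
begin

text \<open>
  All sets of a dynamic theory are explicit carriers: variables, atoms and programs may be
  empty, which types cannot be. The three kinds of symbols are drawn from one type \<open>'x\<close>, so
  that their disjointness is a genuine condition. The components \<open>val\<close>, \<open>atom_eval\<close>,
  \<open>atom_fv\<close>, \<open>prog_eval\<close> and \<open>prog_fv\<close> are relevant only on the respective carriers.
\<close>

record ('x, 'u, 's) dyn_theory =
  vars :: "'x set"
  atoms :: "'x set"
  programs :: "'x set"
  universe :: "'u set"
  states :: "'s set"
  val :: "'s \<Rightarrow> 'x \<Rightarrow> 'u"
  atom_eval :: "'x \<Rightarrow> 's set"
  atom_fv :: "'x \<Rightarrow> 'x set"
  prog_eval :: "'x \<Rightarrow> ('s \<times> 's) set"
  prog_fv :: "'x \<Rightarrow> 'x set"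

definition agree :: "('x, 'u, 's) dyn_theory \<Rightarrow> 'x set \<Rightarrow> 's \<Rightarrow> 's \<Rightarrow> bool" where
  "agree D W \<mu> \<nu> \<longleftrightarrow> (\<forall>v\<in>W. val D \<mu> v = val D \<nu> v)"

locale dynamic_theory =
  fixes D :: "('x, 'u, 's) dyn_theory"
  assumes vars_atoms_disjoint: "vars D \<inter> atoms D = {}"
    and vars_programs_disjoint: "vars D \<inter> programs D = {}"
    and atoms_programs_disjoint: "atoms D \<inter> programs D = {}"
    and universe_nonempty: "universe D \<noteq> {}"
    and states_nonempty: "states D \<noteq> {}"
    and val_in_universe: "\<And>\<mu> v. \<mu> \<in> states D \<Longrightarrow> v \<in> vars D \<Longrightarrow> val D \<mu> v \<in> universe D"
    and interpolation:
      "\<And>\<mu> \<nu> W. \<mu> \<in> states D \<Longrightarrow> \<nu> \<in> states D \<Longrightarrow> W \<subseteq> vars D \<Longrightarrow>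
        \<exists>\<omega>\<in>states D. agree D W \<omega> \<mu> \<and> agree D (vars D - W) \<omega> \<nu>"
    and atom_eval_states: "\<And>a. a \<in> atoms D \<Longrightarrow> atom_eval D a \<subseteq> states D"
    and atom_fv_vars: "\<And>a. a \<in> atoms D \<Longrightarrow> atom_fv D a \<subseteq> vars D"
    and atom_fv_finite: "\<And>a. a \<in> atoms D \<Longrightarrow> finite (atom_fv D a)"
    and atom_coincidence:
      "\<And>a \<mu> \<nu>. a \<in> atoms D \<Longrightarrow> \<mu> \<in> states D \<Longrightarrow> \<nu> \<in> states D \<Longrightarrow>
        agree D (atom_fv D a) \<mu> \<nu> \<Longrightarrow> \<mu> \<in> atom_eval D a \<longleftrightarrow> \<nu> \<in> atom_eval D a"
    and prog_eval_states: "\<And>p. p \<in> programs D \<Longrightarrow> prog_eval D p \<subseteq> states D \<times> states D"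
    and prog_fv_vars: "\<And>p. p \<in> programs D \<Longrightarrow> prog_fv D p \<subseteq> vars D"
    and prog_fv_finite: "\<And>p. p \<in> programs D \<Longrightarrow> finite (prog_fv D p)"
    and prog_overapproximation:
      "\<And>p \<mu> \<nu> \<omega> W. p \<in> programs D \<Longrightarrow>
        \<mu> \<in> states D \<Longrightarrow> \<nu> \<in> states D \<Longrightarrow> \<omega> \<in> states D \<Longrightarrow>
        prog_fv D p \<subseteq> W \<Longrightarrow> W \<subseteq> vars D \<Longrightarrow>
        agree D W \<mu> \<nu> \<Longrightarrow> (\<mu>, \<omega>) \<in> prog_eval D p \<Longrightarrow>
        \<exists>\<omega>'\<in>states D. (\<nu>, \<omega>') \<in> prog_eval D p \<and> agree D W \<omega> \<omega>'"
    and prog_extensionality: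
      "\<And>p \<mu> \<nu> \<omega>. p \<in> programs D \<Longrightarrow>
        \<mu> \<in> states D \<Longrightarrow> \<nu> \<in> states D \<Longrightarrow> \<omega> \<in> states D \<Longrightarrow>
        agree D (vars D) \<mu> \<nu> \<Longrightarrow>
        (\<mu>, \<omega>) \<in> prog_eval D p \<longleftrightarrow> (\<nu>, \<omega>) \<in> prog_eval D p"

datatype 'x fml =
    Atom 'x
  | Neg "'x fml"
  | Conj "'x fml" "'x fml"
  | All 'x "'x fml"
  | Box 'x "'x fml"

definition Impl :: "'x fml \<Rightarrow> 'x fml \<Rightarrow> 'x fml" where
  "Impl F G = Neg (Conj F (Neg G))"

definition Equi :: "'x fml \<Rightarrow> 'x fml \<Rightarrow> 'x fml" where
  "Equi F G = Conj (Impl F G) (Impl G F)"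

inductive_set formulas :: "('x, 'u, 's) dyn_theory \<Rightarrow> 'x fml set"
  for D :: "('x, 'u, 's) dyn_theory" where
  Atom: "a \<in> atoms D \<Longrightarrow> Atom a \<in> formulas D"
| Neg: "F \<in> formulas D \<Longrightarrow> Neg F \<in> formulas D"
| Conj: "F \<in> formulas D \<Longrightarrow> G \<in> formulas D \<Longrightarrow> Conj F G \<in> formulas D"
| All: "v \<in> vars D \<Longrightarrow> F \<in> formulas D \<Longrightarrow> All v F \<in> formulas D"
| Box: "p \<in> programs D \<Longrightarrow> F \<in> formulas D \<Longrightarrow> Box p F \<in> formulas D"

primrec sem :: "('x, 'u, 's) dyn_theory \<Rightarrow> 'x fml \<Rightarrow> 's set" where
  "sem D (Atom a) = atom_eval D a"
| "sem D (Neg F) = states D - sem D F"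
| "sem D (Conj F G) = sem D F \<inter> sem D G"
| "sem D (All v F) =
    {\<mu> \<in> states D. \<forall>\<nu>\<in>states D. agree D (vars D - {v}) \<mu> \<nu> \<longrightarrow> \<nu> \<in> sem D F}"
| "sem D (Box p F) =
    {\<mu> \<in> states D. \<forall>\<nu>\<in>states D. (\<mu>, \<nu>) \<in> prog_eval D p \<longrightarrow> \<nu> \<in> sem D F}"

definition valid :: "('x, 'u, 's) dyn_theory \<Rightarrow> 'x fml \<Rightarrow> bool" where
  "valid D F \<longleftrightarrow> sem D F = states D"

definition sem_fv_fml :: "('x, 'u, 's) dyn_theory \<Rightarrow> 'x fml \<Rightarrow> 'x set" where
  "sem_fv_fml D F =
    {v \<in> vars D. \<exists>\<mu>\<in>states D. \<exists>\<mu>'\<in>states D.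
      agree D (vars D - {v}) \<mu> \<mu>' \<and> \<mu> \<in> sem D F \<and> \<mu>' \<notin> sem D F}"

definition sem_fv_prog :: "('x, 'u, 's) dyn_theory \<Rightarrow> 'x \<Rightarrow> 'x set" where
  "sem_fv_prog D p =
    {v \<in> vars D. \<exists>\<mu>\<in>states D. \<exists>\<mu>'\<in>states D. \<exists>\<nu>\<in>states D.
      agree D (vars D - {v}) \<mu> \<mu>' \<and> (\<mu>, \<nu>) \<in> prog_eval D p \<and>
      \<not> (\<exists>\<nu>'\<in>states D. agree D (vars D - {v}) \<nu> \<nu>' \<and> (\<mu>', \<nu>') \<in> prog_eval D p)}"

definition sem_bv_prog :: "('x, 'u, 's) dyn_theory \<Rightarrow> 'x \<Rightarrow> 'x set" where
  "sem_bv_prog D p =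
    {v \<in> vars D. \<exists>\<mu>\<in>states D. \<exists>\<mu>'\<in>states D.
      (\<mu>, \<mu>') \<in> prog_eval D p \<and> val D \<mu> v \<noteq> val D \<mu>' v}"

end

theory Submission imports Defs begin

text \<open>
  The step of interest is (V). The program may change infinitely many variables, so one cannot
  pass from the initial to the final state one variable at a time. But overapproximation gives
  every formula a finite set of variables that determines its truth, and only finitely many
  changes then matter, none of them at a semantically free variable.
  For (B), a transition is transported along a change of \<open>v\<close> because \<open>v\<close> is not
  semantically free in the program, and the value of \<open>v\<close> survives because \<open>v\<close> is not bound.
\<close>

lemma agree_sym: "agree D W \<mu> \<nu> \<Longrightarrow> agree D W \<nu> \<mu>"
  by (simp add: agree_def)

lemma agree_mono: "agree D W \<mu> \<nu> \<Longrightarrow> X \<subseteq> W \<Longrightarrow> agree D X \<mu> \<nu>"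
  by (auto simp: agree_def)

text \<open>The definition of \<open>sem_fv_fml\<close> excludes only a change from true to false.
  Agreement is symmetric, so exchanging the two states excludes the other direction.\<close>

lemma sem_iff_outside_sem_fv:
  assumes "v \<in> vars D" "v \<notin> sem_fv_fml D F" "\<mu> \<in> states D" "\<nu> \<in> states D"
    and "agree D (vars D - {v}) \<mu> \<nu>"
  shows "\<mu> \<in> sem D F \<longleftrightarrow> \<nu> \<in> sem D F"
  using assms agree_sym[OF assms(5)] unfolding sem_fv_fml_def by blast

lemma transition_outside_sem_fv:
  assumes "v \<in> vars D" "v \<notin> sem_fv_prog D p"
    and "\<mu> \<in> states D" "\<mu>' \<in> states D" "\<nu> \<in> states D"
    and "agree D (vars D - {v}) \<mu> \<mu>'" "(\<mu>, \<nu>) \<in> prog_eval D p"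
  obtains \<nu>' where "\<nu>' \<in> states D" "agree D (vars D - {v}) \<nu> \<nu>'" "(\<mu>', \<nu>') \<in> prog_eval D p"
  using assms unfolding sem_fv_prog_def by blast

lemma val_outside_sem_bv:
  assumes "v \<in> vars D" "v \<notin> sem_bv_prog D p" "\<mu> \<in> states D" "\<nu> \<in> states D" "(\<mu>, \<nu>) \<in> prog_eval D p"
  shows "val D \<mu> v = val D \<nu> v"
  using assms unfolding sem_bv_prog_def by blast

lemma valid_necessitation: "valid D \<phi> \<Longrightarrow> valid D (Box \<alpha> \<phi>)"
  by (auto simp: valid_def)

lemma valid_distribution: "valid D (Impl (Box \<alpha> (Impl \<phi> \<psi>)) (Impl (Box \<alpha> \<phi>) (Box \<alpha> \<psi>)))"
  by (auto simp: valid_def Impl_def)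

context dynamic_theory
begin

lemma sem_subset_states: "F \<in> formulas D \<Longrightarrow> sem D F \<subseteq> states D"
  by (induction rule: formulas.induct) (use atom_eval_states in auto)

text \<open>Interpolation for the singleton of \<open>v\<close>: the value at \<open>v\<close> is
  taken from \<nu>, all others from \<mu>. This is the basic move for altering a state in one
  variable.\<close>

lemma exchange_value:
  assumes "\<mu> \<in> states D" "\<nu> \<in> states D" "v \<in> vars D"
  obtains \<omega> where "\<omega> \<in> states D" "agree D (vars D - {v}) \<mu> \<omega>" "val D \<omega> v = val D \<nu> v"
  using interpolation[of \<nu> \<mu> "{v}"] assms by (auto simp: agree_def)

text \<open>The set collected by the induction consists of syntactic free variables and may well
  exceed \<open>sem_fv_fml\<close>; what matters is its finiteness. One implication suffices because
  the two states are arbitrary and agreement is symmetric; the negation case uses it with their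
  roles exchanged.\<close>

lemma finite_coincidence:
  assumes "F \<in> formulas D"
  obtains X where "finite X" "X \<subseteq> vars D"
    "\<And>\<mu> \<nu>. \<mu> \<in> states D \<Longrightarrow> \<nu> \<in> states D \<Longrightarrow> agree D X \<mu> \<nu> \<Longrightarrow> \<mu> \<in> sem D F \<Longrightarrow> \<nu> \<in> sem D F"
  using assms
proof (induction arbitrary: thesis rule: formulas.induct)
  case (Atom a)
  show ?case
  proof (rule Atom.prems)
    show "\<nu> \<in> sem D (Atom a)"
      if "\<mu> \<in> states D" "\<nu> \<in> states D" "agree D (atom_fv D a) \<mu> \<nu>" "\<mu> \<in> sem D (Atom a)" for \<mu> \<nu>
      using atom_coincidence[OF Atom.hyps that(1-3)] that(4) by simp
  qed (use Atom.hyps atom_fv_finite atom_fv_vars in auto)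
next
  case (Neg F)
  obtain X where X: "finite X" "X \<subseteq> vars D"
      "\<And>\<mu> \<nu>. \<mu> \<in> states D \<Longrightarrow> \<nu> \<in> states D \<Longrightarrow> agree D X \<mu> \<nu> \<Longrightarrow> \<mu> \<in> sem D F \<Longrightarrow> \<nu> \<in> sem D F"
    using Neg.IH by blast
  show ?case
  proof (rule Neg.prems[OF X(1,2)])
    show "\<nu> \<in> sem D (Neg F)"
      if "\<mu> \<in> states D" "\<nu> \<in> states D" "agree D X \<mu> \<nu>" "\<mu> \<in> sem D (Neg F)" for \<mu> \<nu>
      using X(3)[OF that(2,1) agree_sym[OF that(3)]] that(2,4) by auto
  qed
next
  case (Conj F G)
  obtain X where X: "finite X" "X \<subseteq> vars D"
      "\<And>\<mu> \<nu>. \<mu> \<in> states D \<Longrightarrow> \<nu> \<in> states D \<Longrightarrow> agree D X \<mu> \<nu> \<Longrightarrow> \<mu> \<in> sem D F \<Longrightarrow> \<nu> \<in> sem D F"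
    using Conj.IH(1) by blast
  obtain Y where Y: "finite Y" "Y \<subseteq> vars D"
      "\<And>\<mu> \<nu>. \<mu> \<in> states D \<Longrightarrow> \<nu> \<in> states D \<Longrightarrow> agree D Y \<mu> \<nu> \<Longrightarrow> \<mu> \<in> sem D G \<Longrightarrow> \<nu> \<in> sem D G"
    using Conj.IH(2) by blast
  show ?case
  proof (rule Conj.prems)
    show "\<nu> \<in> sem D (Conj F G)"
      if "\<mu> \<in> states D" "\<nu> \<in> states D" "agree D (X \<union> Y) \<mu> \<nu>" "\<mu> \<in> sem D (Conj F G)" for \<mu> \<nu>
      using X(3)[OF that(1,2) agree_mono[OF that(3)]] Y(3)[OF that(1,2) agree_mono[OF that(3)]]
        that(4) by simp
  qed (use X(1,2) Y(1,2) in auto)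
next
  case (All v F)
  obtain X where X: "finite X" "X \<subseteq> vars D"
      "\<And>\<mu> \<nu>. \<mu> \<in> states D \<Longrightarrow> \<nu> \<in> states D \<Longrightarrow> agree D X \<mu> \<nu> \<Longrightarrow> \<mu> \<in> sem D F \<Longrightarrow> \<nu> \<in> sem D F"
    using All.IH by blast
  have "\<nu>' \<in> sem D F"
    if st: "\<mu> \<in> states D" "\<nu> \<in> states D" "\<nu>' \<in> states D"
      and ag: "agree D X \<mu> \<nu>" "agree D (vars D - {v}) \<nu> \<nu>'"
      and \<mu>: "\<mu> \<in> sem D (All v F)"
    for \<mu> \<nu> \<nu>'
  proof -
    \<comment> \<open>The witness \<omega> carries the choice of value for \<open>v\<close> made in
      \<nu>' over to \<mu>. Off \<open>v\<close>, agreement on \<open>X\<close> runs from \<omega>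
      through \<mu> and \<nu> to \<nu>'.\<close>
    obtain \<omega> where \<omega>: "\<omega> \<in> states D" "agree D (vars D - {v}) \<mu> \<omega>" "val D \<omega> v = val D \<nu>' v"
      using exchange_value[OF st(1,3) All.hyps(1)] by blast
    have "agree D X \<omega> \<nu>'"
      unfolding agree_def
    proof
      fix w assume "w \<in> X"
      then show "val D \<omega> w = val D \<nu>' w"
        using X(2) ag agree_sym[OF \<omega>(2)] \<omega>(3)
        by (cases "w = v") (auto simp: agree_def subset_iff)
    qed
    moreover have "\<omega> \<in> sem D F" using \<mu> \<omega> by simp
    ultimately show ?thesis using X(3) \<omega>(1) st(3) by blast
  qed
  then show ?case by (intro All.prems[OF X(1,2)]) simp
next
  case (Box p F)
  obtain X where X: "finite X" "X \<subseteq> vars D"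
      "\<And>\<mu> \<nu>. \<mu> \<in> states D \<Longrightarrow> \<nu> \<in> states D \<Longrightarrow> agree D X \<mu> \<nu> \<Longrightarrow> \<mu> \<in> sem D F \<Longrightarrow> \<nu> \<in> sem D F"
    using Box.IH by blast
  \<comment> \<open>Overapproximation demands a set that contains \<open>prog_fv D p\<close>;
    including \<open>X\<close> makes the final states agree where the truth of \<open>F\<close> is
    decided.\<close>
  let ?W = "X \<union> prog_fv D p"
  have W: "finite ?W" "?W \<subseteq> vars D"
    using X(1,2) prog_fv_finite[OF Box.hyps(1)] prog_fv_vars[OF Box.hyps(1)] by auto
  have "\<nu>' \<in> sem D F"
    if st: "\<mu> \<in> states D" "\<nu> \<in> states D" "\<nu>' \<in> states D"
      and ag: "agree D ?W \<mu> \<nu>" and tr: "(\<nu>, \<nu>') \<in> prog_eval D p"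
      and \<mu>: "\<mu> \<in> sem D (Box p F)"
    for \<mu> \<nu> \<nu>'
  proof -
    obtain \<mu>' where \<mu>': "\<mu>' \<in> states D" "(\<mu>, \<mu>') \<in> prog_eval D p" "agree D ?W \<nu>' \<mu>'"
      using prog_overapproximation[OF Box.hyps(1) st(2,1,3) Un_upper2 W(2) agree_sym[OF ag] tr]
      by blast
    then have "\<mu>' \<in> sem D F" using \<mu> by simp
    then show ?thesis
      using X(3)[OF \<mu>'(1) st(3) agree_mono[OF agree_sym[OF \<mu>'(3)]]] by blast
  qed
  then show ?case by (intro Box.prems[OF W]) simp
qed

text \<open>The values of \<nu> are copied into \<mu> one variable at a time. Each copied variable
  lies outside \<open>sem_fv_fml D F\<close>, so truth is kept, and
  \<open>finite_coincidence\<close> bounds the number of copies needed before \<nu> itself is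
  reached.\<close>

lemma sem_fv_coincidence:
  assumes F: "F \<in> formulas D" and st: "\<mu> \<in> states D" "\<nu> \<in> states D"
    and ag: "agree D (sem_fv_fml D F) \<mu> \<nu>" and \<mu>: "\<mu> \<in> sem D F"
  shows "\<nu> \<in> sem D F"
proof -
  obtain X where X: "finite X" "X \<subseteq> vars D"
    and coin: "\<And>\<mu> \<nu>. \<mu> \<in> states D \<Longrightarrow> \<nu> \<in> states D \<Longrightarrow> agree D X \<mu> \<nu> \<Longrightarrow>
      \<mu> \<in> sem D F \<Longrightarrow> \<nu> \<in> sem D F"
    using finite_coincidence[OF F] by blast
  \<comment> \<open>Here \<open>Y\<close> holds the variables of \<open>X\<close> that may still
    differ from \<nu>. The state \<mu> is generalized because each induction step replaces it by
    \<omega>, which is corrected at \<open>v\<close>.\<close>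
  have "\<nu> \<in> sem D F"
    if "finite Y" "Y \<subseteq> vars D - sem_fv_fml D F" "\<mu> \<in> states D" "agree D (X - Y) \<mu> \<nu>" "\<mu> \<in> sem D F"
    for Y \<mu>
    using that
  proof (induction Y arbitrary: \<mu> rule: finite_induct)
    case empty
    then show ?case using coin st(2) by simp
  next
    case (insert v Y)
    then have v: "v \<in> vars D" "v \<notin> sem_fv_fml D F" by auto
    obtain \<omega> where \<omega>: "\<omega> \<in> states D" "agree D (vars D - {v}) \<mu> \<omega>" "val D \<omega> v = val D \<nu> v"
      using exchange_value insert.prems(2) st(2) v(1) by blast
    have "\<omega> \<in> sem D F"
      using sem_iff_outside_sem_fv[OF v insert.prems(2) \<omega>(1,2)] insert.prems(4) by blast
    moreover have "agree D (X - Y) \<omega> \<nu>"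
      unfolding agree_def
    proof
      fix w assume "w \<in> X - Y"
      then show "val D \<omega> w = val D \<nu> w"
        using X(2) insert.prems(3) agree_sym[OF \<omega>(2)] \<omega>(3)
        by (cases "w = v") (auto simp: agree_def subset_iff)
    qed
    ultimately show ?case using insert.IH insert.prems(1) \<omega>(1) by blast
  qed
  \<comment> \<open>With this \<open>Y\<close>, the set \<open>X - Y\<close> consists of
    semantically free variables, where agreement is assumed.\<close>
  from this[of "X - sem_fv_fml D F" \<mu>] show ?thesis
    using X st(1) \<mu> ag by (auto simp: agree_def)
qed

text \<open>Distinct states may have the same values. The Barcan argument reaches its target state
  only up to such equality of values.\<close>

lemma sem_extensionality:
  assumes "F \<in> formulas D" "\<mu> \<in> states D" "\<nu> \<in> states D" "agree D (vars D) \<mu> \<nu>" "\<mu> \<in> sem D F"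
  shows "\<nu> \<in> sem D F"
  using sem_fv_coincidence[OF assms(1-3) _ assms(5)] agree_mono[OF assms(4)]
  by (auto simp: sem_fv_fml_def)

lemma valid_Impl_iff:
  "F \<in> formulas D \<Longrightarrow> valid D (Impl F G) \<longleftrightarrow> sem D F \<subseteq> sem D G"
  using sem_subset_states by (auto simp: valid_def Impl_def)

lemma valid_Equi_iff:
  assumes "F \<in> formulas D" "G \<in> formulas D"
  shows "valid D (Equi F G) \<longleftrightarrow> sem D F = sem D G"
  using sem_subset_states[OF assms(1)] sem_subset_states[OF assms(2)]
  by (auto simp: valid_def Equi_def Impl_def)

lemma valid_vacuous:
  assumes "\<phi> \<in> formulas D" and "sem_fv_fml D \<phi> \<inter> sem_bv_prog D \<alpha> = {}"
  shows "valid D (Impl \<phi> (Box \<alpha> \<phi>))"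
proof -
  have "\<nu> \<in> sem D \<phi>"
    if \<mu>: "\<mu> \<in> sem D \<phi>" and \<nu>: "\<nu> \<in> states D" and tr: "(\<mu>, \<nu>) \<in> prog_eval D \<alpha>" for \<mu> \<nu>
  proof -
    have st: "\<mu> \<in> states D" using \<mu> sem_subset_states[OF assms(1)] by blast
    have "val D \<mu> v = val D \<nu> v" if "v \<in> sem_fv_fml D \<phi>" for v
    proof -
      have "v \<in> vars D" "v \<notin> sem_bv_prog D \<alpha>" using that assms(2) by (auto simp: sem_fv_fml_def)
      then show ?thesis using val_outside_sem_bv[OF _ _ st \<nu> tr] by blast
    qed
    then show ?thesis using sem_fv_coincidence[OF assms(1) st \<nu> _ \<mu>] by (simp add: agree_def)
  qed
  then have "sem D \<phi> \<subseteq> sem D (Box \<alpha> \<phi>)"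
    unfolding sem.simps using sem_subset_states[OF assms(1)] by blast
  then show ?thesis by (simp only: valid_Impl_iff[OF assms(1)])
qed

lemma valid_barcan:
  assumes \<alpha>: "\<alpha> \<in> programs D" and \<phi>: "\<phi> \<in> formulas D" and v: "v \<in> vars D"
    and nfv: "v \<notin> sem_fv_prog D \<alpha>" and nbv: "v \<notin> sem_bv_prog D \<alpha>"
  shows "valid D (Equi (All v (Box \<alpha> \<phi>)) (Box \<alpha> (All v \<phi>)))"
proof -
  have "sem D (All v (Box \<alpha> \<phi>)) \<subseteq> sem D (Box \<alpha> (All v \<phi>))"
  proof
    fix \<mu> assume \<mu>: "\<mu> \<in> sem D (All v (Box \<alpha> \<phi>))"
    then have \<mu>st: "\<mu> \<in> states D" by simp
    have "\<nu>' \<in> sem D \<phi>"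
      if st: "\<nu> \<in> states D" "\<nu>' \<in> states D" and tr: "(\<mu>, \<nu>) \<in> prog_eval D \<alpha>"
        and ag: "agree D (vars D - {v}) \<nu> \<nu>'"
      for \<nu> \<nu>'
    proof -
      obtain \<mu>' where \<mu>': "\<mu>' \<in> states D" "agree D (vars D - {v}) \<mu> \<mu>'" "val D \<mu>' v = val D \<nu>' v"
        using exchange_value[OF \<mu>st st(2) v] by blast
      obtain \<omega> where \<omega>: "\<omega> \<in> states D" "agree D (vars D - {v}) \<nu> \<omega>" "(\<mu>', \<omega>) \<in> prog_eval D \<alpha>"
        using transition_outside_sem_fv[OF v nfv \<mu>st \<mu>'(1) st(1) \<mu>'(2) tr] by blast
      have "val D \<omega> v = val D \<nu>' v"
        using val_outside_sem_bv[OF v nbv \<mu>'(1) \<omega>(1,3)] \<mu>'(3) by simp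
      then have "agree D (vars D) \<omega> \<nu>'"
        using agree_sym[OF \<omega>(2)] ag by (auto simp: agree_def)
      moreover have "\<omega> \<in> sem D \<phi>" using \<mu> \<mu>' \<omega> by simp
      ultimately show ?thesis using sem_extensionality[OF \<phi> \<omega>(1) st(2)] by blast
    qed
    then show "\<mu> \<in> sem D (Box \<alpha> (All v \<phi>))" unfolding sem.simps using \<mu>st by blast
  qed
  moreover have "sem D (Box \<alpha> (All v \<phi>)) \<subseteq> sem D (All v (Box \<alpha> \<phi>))"
  proof
    fix \<mu> assume \<mu>: "\<mu> \<in> sem D (Box \<alpha> (All v \<phi>))"
    then have \<mu>st: "\<mu> \<in> states D" by simp
    have "\<nu> \<in> sem D \<phi>"
      if st: "\<mu>' \<in> states D" "\<nu> \<in> states D"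
        and ag: "agree D (vars D - {v}) \<mu> \<mu>'" and tr: "(\<mu>', \<nu>) \<in> prog_eval D \<alpha>"
      for \<mu>' \<nu>
    proof -
      \<comment> \<open>The run from \<mu>' is pulled back to start at \<mu>. Its end differs from
        \<nu> at most at \<open>v\<close>, so the quantifier evaluated at \<omega> covers
        \<nu>.\<close>
      obtain \<omega> where \<omega>: "\<omega> \<in> states D" "agree D (vars D - {v}) \<nu> \<omega>" "(\<mu>, \<omega>) \<in> prog_eval D \<alpha>"
        using transition_outside_sem_fv[OF v nfv st(1) \<mu>st st(2) agree_sym[OF ag] tr] by blast
      then have "\<omega> \<in> sem D (All v \<phi>)" using \<mu> by simp
      then show ?thesis using st(2) agree_sym[OF \<omega>(2)] by simp
    qed
    then show "\<mu> \<in> sem D (All v (Box \<alpha> \<phi>))" unfolding sem.simps using \<mu>st by blast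
  qed
  moreover have "All v (Box \<alpha> \<phi>) \<in> formulas D" "Box \<alpha> (All v \<phi>) \<in> formulas D"
    using \<alpha> \<phi> v by (simp_all add: formulas.intros)
  ultimately show ?thesis by (simp only: valid_Equi_iff set_eq_subset simp_thms)
qed

end

theorem mainTheorem1:
  fixes D :: "('x, 'u, 's) dyn_theory"
  assumes "dynamic_theory D"
  shows
    "(\<forall>\<alpha>\<in>programs D. \<forall>\<phi>\<in>formulas D.
        valid D \<phi> \<longrightarrow> valid D (Box \<alpha> \<phi>)) \<and>
     (\<forall>\<alpha>\<in>programs D. \<forall>\<phi>\<in>formulas D. \<forall>\<psi>\<in>formulas D.
        valid D (Impl (Box \<alpha> (Impl \<phi> \<psi>)) (Impl (Box \<alpha> \<phi>) (Box \<alpha> \<psi>)))) \<and>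
     (\<forall>\<alpha>\<in>programs D. \<forall>\<phi>\<in>formulas D.
        sem_fv_fml D \<phi> \<inter> sem_bv_prog D \<alpha> = {} \<longrightarrow>
        valid D (Impl \<phi> (Box \<alpha> \<phi>))) \<and>
     (\<forall>\<alpha>\<in>programs D. \<forall>\<phi>\<in>formulas D. \<forall>v\<in>vars D.
        v \<notin> sem_fv_prog D \<alpha> \<union> sem_bv_prog D \<alpha> \<longrightarrow>
        valid D (Equi (All v (Box \<alpha> \<phi>)) (Box \<alpha> (All v \<phi>))))"
proof -
  interpret dynamic_theory D by fact
  show ?thesis
    by (intro conjI ballI impI valid_necessitation valid_distribution valid_vacuous valid_barcan)
      auto
qed

end
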